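(* Let $(X,d)$ be a compact metric space, let $f:X\to X$ be a continuous surjection, and let $\mathbb{F}=(f_n)_{n\in\mathbb{N}}$ be a sequence of continuous surjections $f_n:X\to X$ converging uniformly to $f$. If the set of periodic points of $(X,\mathbb{F})$ is dense in $X$, then the set of periodic points of $(X,f)$ is dense in $X$.
   Context: For $\mathbb{F}=(f_n)_{n\in\mathbb{N}}$ (with $\mathbb{N}=\{1,2,\dots\}$), put $\omega_n=f_n\circ f_{n-1}\circ\cdots\circ f_1$; $(X,\mathbb{F})$ denotes the non-autonomous system with orbits $\{\omega_n(x):n\in\mathbb{N}\}$. A point $x$ is periodic for $(X,\mathbb{F})$ if there is $n\in\mathbb{N}$ such that $\omega_{nk}(x)=x$ for all $k\in\mathbb{N}$. A point $x$ is periodic for $(X,f)$ if $f^n(x)=x$ for some $n\in\mathbb{N}$. *)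

theory Defs
  imports "HOL-Analysis.Analysis"
begin

text \<open>
  Sequences of maps are indexed by the positive integers: \<open>F n\<close> is only used for \<open>n \<ge> 1\<close>,
  and \<open>F 0\<close> is irrelevant.
\<close>

primrec nads_comp :: "(nat \<Rightarrow> 'a \<Rightarrow> 'a) \<Rightarrow> nat \<Rightarrow> 'a \<Rightarrow> 'a" where
  "nads_comp F 0 = id"
| "nads_comp F (Suc n) = F (Suc n) \<circ> nads_comp F n"

definition nads_periodic_points :: "'a set \<Rightarrow> (nat \<Rightarrow> 'a \<Rightarrow> 'a) \<Rightarrow> 'a set" where
  "nads_periodic_points X F = {x \<in> X. \<exists>n\<ge>1. \<forall>k\<ge>1. nads_comp F (n * k) x = x}"

definition periodic_points :: "'a set \<Rightarrow> ('a \<Rightarrow> 'a) \<Rightarrow> 'a set" where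
  "periodic_points X f = {x \<in> X. \<exists>n\<ge>1. (f ^^ n) x = x}"

definition dense_subset :: "'a::topological_space set \<Rightarrow> 'a set \<Rightarrow> bool" where
  "dense_subset A X \<longleftrightarrow> A \<subseteq> X \<and> X \<subseteq> closure A"

end

theory Submission
  imports Defs
begin

text \<open>
  Every periodic point of the non-autonomous system is already periodic for the limit map. If
  \<open>\<omega>\<^sub>n\<^sub>k x = x\<close> for all \<open>k \<ge> 1\<close>, then \<open>x\<close> is fixed by each block
  \<open>f\<^sub>n\<^sub>k\<^sub>+\<^sub>n \<circ> \<dots> \<circ> f\<^sub>n\<^sub>k\<^sub>+\<^sub>1\<close>, and along \<open>k \<rightarrow> \<infinity>\<close> the value of this block at \<open>x\<close> converges
  to \<open>f\<^sup>n x\<close>.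
\<close>

text \<open>Insert \<open>f (y k)\<close> between \<open>F (s k) (y k)\<close> and
  \<open>f l\<close>. Uniformity bounds the first distance although the argument moves with
  \<open>k\<close>; continuity of \<open>f\<close> on \<open>X\<close> bounds the second.\<close>

lemma uniform_limit_tendsto_compose:
  fixes f :: "'a::topological_space \<Rightarrow> 'b::metric_space"
  assumes lim: "uniform_limit X F f G" and cont: "continuous_on X f"
    and s: "filterlim s G H" and y: "(y \<longlongrightarrow> l) H"
    and yX: "\<forall>\<^sub>F k in H. y k \<in> X" and "l \<in> X"
  shows "((\<lambda>k. F (s k) (y k)) \<longlongrightarrow> f l) H"
proof (rule tendstoI)
  fix e :: real assume "e > 0"
  have "\<forall>\<^sub>F k in H. \<forall>z\<in>X. dist (F (s k) z) (f z) < e / 2"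
    by (rule eventually_compose_filterlim[OF uniform_limitD[OF lim] s]) (use \<open>e > 0\<close> in simp)
  moreover have "((\<lambda>k. f (y k)) \<longlongrightarrow> f l) H"
    by (rule continuous_on_tendsto_compose[OF cont y \<open>l \<in> X\<close> yX])
  then have "\<forall>\<^sub>F k in H. dist (f (y k)) (f l) < e / 2"
    by (rule tendstoD) (use \<open>e > 0\<close> in simp)
  ultimately show "\<forall>\<^sub>F k in H. dist (F (s k) (y k)) (f l) < e"
    using yX by eventually_elim (metis dist_commute dist_triangle_half_r)
qed

lemma nads_comp_in:
  assumes "\<And>n. n \<ge> 1 \<Longrightarrow> F n ` X \<subseteq> X" and "x \<in> X"
  shows "nads_comp F m x \<in> X"
  using assms by (induction m) (auto simp: image_subset_iff)

text \<open>Since \<open>nads_comp F (s k)\<close> eventually fixes \<open>x\<close>, the sequence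
  follows the \<open>j\<close> maps after time \<open>s k\<close>, started at \<open>x\<close>.
  Induction on \<open>j\<close> adds one map at a time, applied to a point that still varies with
  \<open>k\<close>.\<close>

lemma nads_comp_block_tendsto:
  fixes f :: "'a::metric_space \<Rightarrow> 'a"
  assumes cont: "continuous_on X f" and fX: "f ` X \<subseteq> X"
    and FX: "\<And>n. n \<ge> 1 \<Longrightarrow> F n ` X \<subseteq> X"
    and lim: "uniform_limit X F f sequentially"
    and "x \<in> X" and s: "filterlim s sequentially H"
    and per: "\<forall>\<^sub>F k in H. nads_comp F (s k) x = x"
  shows "((\<lambda>k. nads_comp F (s k + j) x) \<longlongrightarrow> (f ^^ j) x) H"
proof (induction j)
  case 0
  show ?case using per by (simp add: tendsto_eventually)
next
  case (Suc j)
  have "(f ^^ j) x \<in> X" using fX \<open>x \<in> X\<close> by (induction j) auto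
  \<comment> \<open>This is the index of the newly added outermost map, which must tend to infinity
    for uniform convergence to apply.\<close>
  moreover have "filterlim (\<lambda>k. Suc (s k + j)) sequentially H"
    by (rule filterlim_at_top_mono[OF s]) simp
  ultimately show ?case
    using uniform_limit_tendsto_compose[OF lim cont _ Suc]
      nads_comp_in[OF FX \<open>x \<in> X\<close>] by simp
qed

lemma nads_periodic_points_subset:
  fixes f :: "'a::metric_space \<Rightarrow> 'a"
  assumes "continuous_on X f" and "f ` X \<subseteq> X"
    and "\<And>n. n \<ge> 1 \<Longrightarrow> F n ` X \<subseteq> X"
    and "uniform_limit X F f sequentially"
  shows "nads_periodic_points X F \<subseteq> periodic_points X f"
proof
  fix x assume "x \<in> nads_periodic_points X F"
  then obtain n where x: "x \<in> X" and n: "n \<ge> 1"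
    and per: "\<And>k. k \<ge> 1 \<Longrightarrow> nads_comp F (n * k) x = x"
    by (auto simp: nads_periodic_points_def)
  have "filterlim (\<lambda>k. n * k) sequentially sequentially"
    by (rule filterlim_at_top_mono[OF filterlim_ident]) (use n in simp)
  moreover have "\<forall>\<^sub>F k in sequentially. nads_comp F (n * k) x = x"
    using eventually_ge_at_top[of 1] by eventually_elim (rule per)
  ultimately have "(\<lambda>k. nads_comp F (n * k + n) x) \<longlonglongrightarrow> (f ^^ n) x"
    using nads_comp_block_tendsto[OF assms x] by blast
  \<comment> \<open>As \<open>n * k + n = n * Suc k\<close>, periodicity applies even at
    \<open>k = 0\<close>. The sequence is thus constantly \<open>x\<close>, and uniqueness of limits
    gives the claim.\<close>
  moreover have "nads_comp F (n * k + n) x = x" for k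
    using per[of "Suc k"] by (simp add: add.commute)
  ultimately have "(f ^^ n) x = x"
    by (simp add: LIMSEQ_const_iff)
  with x n show "x \<in> periodic_points X f"
    by (auto simp: periodic_points_def)
qed

theorem corollary8:
  fixes X :: "'a::metric_space set"
    and f :: "'a \<Rightarrow> 'a"
    and F :: "nat \<Rightarrow> 'a \<Rightarrow> 'a"
  assumes "compact X"
    and "continuous_on X f" and "f ` X = X"
    and "\<And>n. n \<ge> 1 \<Longrightarrow> continuous_on X (F n)"
    and "\<And>n. n \<ge> 1 \<Longrightarrow> F n ` X = X"
    and "uniform_limit X F f sequentially"
    and "dense_subset (nads_periodic_points X F) X"
  shows "dense_subset (periodic_points X f) X"
proof -
  have "nads_periodic_points X F \<subseteq> periodic_points X f"
    using assms by (intro nads_periodic_points_subset) auto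
  then have "closure (nads_periodic_points X F) \<subseteq> closure (periodic_points X f)"
    by (rule closure_mono)
  then show ?thesis
    using assms(7) by (auto simp: dense_subset_def periodic_points_def)
qed

end
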